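(* The logic $\mathsf{BCL}$ is sound and complete relative to the class of classifier models: for every $\varphi\in\mathcal{L}(\mathit{Atm})$, $\varphi$ is a theorem of $\mathsf{BCL}$ if and only if $(C,s)\models\varphi$ for every classifier model $C=(S,f)$ and every $s\in S$.
   Context: $\mathit{Atm}$ is a finite set of atomic propositions containing the decision atoms $\mathit{Dec}=\{\mathsf{t}(x):x\in\mathit{Val}\}$, $\mathit{Val}$ a finite set of decision values. Language $\mathcal{L}(\mathit{Atm})$: $\varphi::=p\mid\neg\varphi\mid\varphi\wedge\varphi\mid[X]\varphi$ with $p\in\mathit{Atm}$, $X\subseteq\mathit{Atm}$; $\langle X\rangle\varphi:=\neg[X]\neg\varphi$. A classifier model is $C=(S,f)$, $S=2^{\mathit{Atm}\setminus\mathit{Dec}}$, $f:S\to\mathit{Val}$; at $(C,s)$: $p\in\mathit{Atm}\setminus\mathit{Dec}$ true iff $p\in s$; $\mathsf{t}(x)$ true iff $f(s)=x$; Boolean clauses as usual; $[X]\varphi$ true iff $\varphi$ true at all $s'\in S$ with $s\cap X=s'\cap X$. For finite $X,Y\subseteq\mathit{Atm}$ let $\mathrm{cn}(Y,X)=\bigwedge_{p\in Y}p\wedge\bigwedge_{p\in X\setminus Y}\neg p$. $\mathsf{BCL}$ is the extension of classical propositional logic by the axiom schemas (for all formulas $\varphi,\psi$, all $X\subseteq\mathit{Atm}$, all $x,y\in\mathit{Val}$): (K) $([\emptyset]\varphi\wedge[\emptyset](\varphi\to\psi))\to[\emptyset]\psi$; (T) $[\emptyset]\varphi\to\varphi$;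 (4) $[\emptyset]\varphi\to[\emptyset][\emptyset]\varphi$; (B) $\varphi\to[\emptyset]\langle\emptyset\rangle\varphi$; (Red) $[X]\varphi\leftrightarrow\bigwedge_{Y\subseteq X}(\mathrm{cn}(Y,X)\to[\emptyset](\mathrm{cn}(Y,X)\to\varphi))$; (AtLeast) $\bigvee_{x\in\mathit{Val}}\mathsf{t}(x)$; (AtMost) $\mathsf{t}(x)\to\neg\mathsf{t}(y)$ for $x\ne y$; (Def) $\bigwedge_{Y\subseteq\mathit{Atm}\setminus\mathit{Dec}}\big((\mathrm{cn}(Y,\mathit{Atm}\setminus\mathit{Dec})\wedge\mathsf{t}(x))\to[\emptyset](\mathrm{cn}(Y,\mathit{Atm}\setminus\mathit{Dec})\to\mathsf{t}(x))\big)$; (Comp) $\bigwedge_{Y\subseteq\mathit{Atm}\setminus\mathit{Dec}}\langle\emptyset\rangle\mathrm{cn}(Y,\mathit{Atm}\setminus\mathit{Dec})$; and the rules modus ponens and necessitation (from $\varphi$ infer $[\emptyset]\varphi$).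
   Formalization: If X contains decision atoms, (Red) is unsound for the clause s∩X=s'∩X. So this clause is kept only for formulas whose boxes [X] all have X⊆Atm∖Dec; for all of L(Atm) the result is proved with [X] fixing the truth values of all atoms in X, decision atoms included. *)

theory Defs
  imports "HOL-Library.FuncSet"
begin

datatype 'a fm = Atom 'a | Neg "'a fm" | Conj "'a fm" "'a fm" | Box "'a set" "'a fm"

definition Imp :: "'a fm \<Rightarrow> 'a fm \<Rightarrow> 'a fm" where
  "Imp \<phi> \<psi> = Neg (Conj \<phi> (Neg \<psi>))"

definition Disj :: "'a fm \<Rightarrow> 'a fm \<Rightarrow> 'a fm" where
  "Disj \<phi> \<psi> = Neg (Conj (Neg \<phi>) (Neg \<psi>))"

definition Iff :: "'a fm \<Rightarrow> 'a fm \<Rightarrow> 'a fm" where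
  "Iff \<phi> \<psi> = Conj (Imp \<phi> \<psi>) (Imp \<psi> \<phi>)"

definition Dia :: "'a set \<Rightarrow> 'a fm \<Rightarrow> 'a fm" where
  "Dia X \<phi> = Neg (Box X (Neg \<phi>))"

text \<open>Propositional tautologies: atoms and boxed formulas get arbitrary, independent truth
  values, so these are the substitution instances of classical tautologies.\<close>

primrec peval :: "('a fm \<Rightarrow> bool) \<Rightarrow> 'a fm \<Rightarrow> bool" where
  "peval v (Atom p) \<longleftrightarrow> v (Atom p)"
| "peval v (Neg \<phi>) \<longleftrightarrow> \<not> peval v \<phi>"
| "peval v (Conj \<phi> \<psi>) \<longleftrightarrow> peval v \<phi> \<and> peval v \<psi>"
| "peval v (Box X \<phi>) \<longleftrightarrow> v (Box X \<phi>)"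

definition tautology :: "'a fm \<Rightarrow> bool" where
  "tautology \<phi> \<longleftrightarrow> (\<forall>v. peval v \<phi>)"

primrec modalities :: "'a fm \<Rightarrow> 'a set set" where
  "modalities (Atom p) = {}"
| "modalities (Neg \<phi>) = modalities \<phi>"
| "modalities (Conj \<phi> \<psi>) = modalities \<phi> \<union> modalities \<psi>"
| "modalities (Box X \<phi>) = insert X (modalities \<phi>)"

text \<open>Distinct values have distinct decision atoms. \<open>Val\<close>, or the set of non-decision atoms,
  may be empty.\<close>

locale bcl =
  fixes Atm :: "'a set" and Val :: "'v set" and t :: "'v \<Rightarrow> 'a"
  assumes finite_Atm: "finite Atm"
    and finite_Val: "finite Val"
    and t_in_Atm: "t ` Val \<subseteq> Atm"
    and inj_t: "inj_on t Val"
begin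

definition Dec :: "'a set" where
  "Dec = t ` Val"

inductive_set lang :: "'a fm set" where
  "p \<in> Atm \<Longrightarrow> Atom p \<in> lang"
| "\<phi> \<in> lang \<Longrightarrow> Neg \<phi> \<in> lang"
| "\<phi> \<in> lang \<Longrightarrow> \<psi> \<in> lang \<Longrightarrow> Conj \<phi> \<psi> \<in> lang"
| "X \<subseteq> Atm \<Longrightarrow> \<phi> \<in> lang \<Longrightarrow> Box X \<phi> \<in> lang"

text \<open>The grammar has no constant for truth, so the empty conjunction is \<open>\<not> (p \<and> \<not> p)\<close> for some
  atom \<open>p\<close>; if there is no atom then \<open>lang\<close> is empty. Finite conjunctions and disjunctions are
  formed along an arbitrary fixed enumeration of the index set.\<close>

definition Top :: "'a fm" where
  "Top = (let p = Atom (SOME p. p \<in> Atm) in Neg (Conj p (Neg p)))"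

definition enum_of :: "'i set \<Rightarrow> 'i list" where
  "enum_of I = (SOME is. set is = I \<and> distinct is)"

definition BigConj :: "'i set \<Rightarrow> ('i \<Rightarrow> 'a fm) \<Rightarrow> 'a fm" where
  "BigConj I F = foldr (\<lambda>i. Conj (F i)) (enum_of I) Top"

definition BigDisj :: "'i set \<Rightarrow> ('i \<Rightarrow> 'a fm) \<Rightarrow> 'a fm" where
  "BigDisj I F = foldr (\<lambda>i. Disj (F i)) (enum_of I) (Neg Top)"

definition cn :: "'a set \<Rightarrow> 'a set \<Rightarrow> 'a fm" where
  "cn Y X = Conj (BigConj Y Atom) (BigConj (X - Y) (\<lambda>p. Neg (Atom p)))"

inductive BCL :: "'a fm \<Rightarrow> bool" where
  Taut: "\<phi> \<in> lang \<Longrightarrow> tautology \<phi> \<Longrightarrow> BCL \<phi>"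
| K: "\<phi> \<in> lang \<Longrightarrow> \<psi> \<in> lang \<Longrightarrow>
    BCL (Imp (Conj (Box {} \<phi>) (Box {} (Imp \<phi> \<psi>))) (Box {} \<psi>))"
| T: "\<phi> \<in> lang \<Longrightarrow> BCL (Imp (Box {} \<phi>) \<phi>)"
| Four: "\<phi> \<in> lang \<Longrightarrow> BCL (Imp (Box {} \<phi>) (Box {} (Box {} \<phi>)))"
| B: "\<phi> \<in> lang \<Longrightarrow> BCL (Imp \<phi> (Box {} (Dia {} \<phi>)))"
| Red: "\<phi> \<in> lang \<Longrightarrow> X \<subseteq> Atm \<Longrightarrow>
    BCL (Iff (Box X \<phi>)
      (BigConj (Pow X) (\<lambda>Y. Imp (cn Y X) (Box {} (Imp (cn Y X) \<phi>)))))"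
| AtLeast: "BCL (BigDisj Val (\<lambda>x. Atom (t x)))"
| AtMost: "x \<in> Val \<Longrightarrow> y \<in> Val \<Longrightarrow> x \<noteq> y \<Longrightarrow> BCL (Imp (Atom (t x)) (Neg (Atom (t y))))"
| Def: "x \<in> Val \<Longrightarrow>
    BCL (BigConj (Pow (Atm - Dec)) (\<lambda>Y.
      Imp (Conj (cn Y (Atm - Dec)) (Atom (t x)))
        (Box {} (Imp (cn Y (Atm - Dec)) (Atom (t x))))))"
| Comp: "BCL (BigConj (Pow (Atm - Dec)) (\<lambda>Y. Dia {} (cn Y (Atm - Dec))))"
| MP: "BCL \<phi> \<Longrightarrow> BCL (Imp \<phi> \<psi>) \<Longrightarrow> BCL \<psi>"
| Nec: "BCL \<phi> \<Longrightarrow> BCL (Box {} \<phi>)"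

definition classifier_model :: "'a set set \<times> ('a set \<Rightarrow> 'v) \<Rightarrow> bool" where
  "classifier_model C \<longleftrightarrow> (case C of (S, f) \<Rightarrow> S = Pow (Atm - Dec) \<and> f \<in> S \<rightarrow> Val)"

definition atom_true :: "'a set set \<times> ('a set \<Rightarrow> 'v) \<Rightarrow> 'a set \<Rightarrow> 'a \<Rightarrow> bool" where
  "atom_true C s p \<longleftrightarrow> (if p \<in> Dec then \<exists>x\<in>Val. p = t x \<and> snd C s = x else p \<in> s)"

primrec sat :: "'a set set \<times> ('a set \<Rightarrow> 'v) \<Rightarrow> 'a set \<Rightarrow> 'a fm \<Rightarrow> bool" where
  "sat C s (Atom p) \<longleftrightarrow> atom_true C s p"
| "sat C s (Neg \<phi>) \<longleftrightarrow> \<not> sat C s \<phi>"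
| "sat C s (Conj \<phi> \<psi>) \<longleftrightarrow> sat C s \<phi> \<and> sat C s \<psi>"
| "sat C s (Box X \<phi>) \<longleftrightarrow> (\<forall>s'\<in>fst C. s \<inter> X = s' \<inter> X \<longrightarrow> sat C s' \<phi>)"

text \<open>States contain no decision atoms, so \<open>sat\<close> ignores the decision atoms in \<open>X\<close>, whereas the
  axiom \<open>Red\<close> does not: with two values and one non-decision atom, \<open>Red\<close> is unsound for \<open>sat\<close> at
  \<open>X = {t x}\<close> (lemma \<open>Red_unsound\<close> below). The following variant compares the truth values of
  all atoms in \<open>X\<close>, decision atoms included. For \<open>X \<subseteq> Atm - Dec\<close> both clauses coincide.\<close>

primrec sat_dec :: "'a set set \<times> ('a set \<Rightarrow> 'v) \<Rightarrow> 'a set \<Rightarrow> 'a fm \<Rightarrow> bool" where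
  "sat_dec C s (Atom p) \<longleftrightarrow> atom_true C s p"
| "sat_dec C s (Neg \<phi>) \<longleftrightarrow> \<not> sat_dec C s \<phi>"
| "sat_dec C s (Conj \<phi> \<psi>) \<longleftrightarrow> sat_dec C s \<phi> \<and> sat_dec C s \<psi>"
| "sat_dec C s (Box X \<phi>) \<longleftrightarrow>
    (\<forall>s'\<in>fst C. {p. atom_true C s p} \<inter> X = {p. atom_true C s' p} \<inter> X \<longrightarrow> sat_dec C s' \<phi>)"

lemma sat_dec_eq_sat:
  assumes "\<forall>X\<in>modalities \<phi>. X \<subseteq> Atm - Dec"
  shows "sat_dec C s \<phi> \<longleftrightarrow> sat C s \<phi>"
  using assms
proof (induction \<phi> arbitrary: s)
  case (Box X \<phi>)
  have "{p. atom_true C s p} \<inter> X = s \<inter> X" for s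
    using Box.prems by (auto simp: atom_true_def)
  with Box show ?case by simp
qed auto

lemma set_enum_of: "finite I \<Longrightarrow> set (enum_of I) = I"
  unfolding enum_of_def using someI_ex[OF finite_distinct_list] by blast

lemma sat_BigConj: "finite I \<Longrightarrow> sat C s (BigConj I F) \<longleftrightarrow> (\<forall>i\<in>I. sat C s (F i))"
proof -
  assume "finite I"
  have "sat C s (foldr (\<lambda>i. Conj (F i)) is Top) \<longleftrightarrow> (\<forall>i\<in>set is. sat C s (F i))" for "is"
    by (induction "is") (auto simp: Top_def Let_def)
  with set_enum_of[OF \<open>finite I\<close>] show ?thesis by (simp add: BigConj_def)
qed

lemma sat_cn:
  "finite X \<Longrightarrow> Y \<subseteq> X \<Longrightarrow>
    sat C s (cn Y X) \<longleftrightarrow> (\<forall>p\<in>Y. atom_true C s p) \<and> (\<forall>p\<in>X - Y. \<not> atom_true C s p)"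
  by (simp add: cn_def sat_BigConj finite_subset)

lemma lang_BigConj:
  assumes "finite I" "Atm \<noteq> {}" "\<And>i. i \<in> I \<Longrightarrow> F i \<in> lang"
  shows "BigConj I F \<in> lang"
proof -
  have "Top \<in> lang"
    using assms(2) by (auto simp: Top_def Let_def some_in_eq intro!: lang.intros)
  hence "set is \<subseteq> I \<Longrightarrow> foldr (\<lambda>i. Conj (F i)) is Top \<in> lang" for "is"
    using assms(3) by (induction "is") (auto intro: lang.intros)
  with set_enum_of[OF assms(1)] show ?thesis by (simp add: BigConj_def)
qed

lemma lang_cn:
  assumes "X \<subseteq> Atm" "Y \<subseteq> X" "Atm \<noteq> {}"
  shows "cn Y X \<in> lang"
proof -
  have "finite X" "finite Y"
    using assms finite_Atm by (meson finite_subset)+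
  then show ?thesis
    unfolding cn_def using assms by (auto intro!: lang.intros lang_BigConj)
qed

lemma Red_unsound:
  assumes "x \<in> Val" "y \<in> Val" "x \<noteq> y" "q \<in> Atm - Dec"
  shows "\<exists>\<phi>\<in>lang. BCL \<phi> \<and> (\<exists>S f. classifier_model (S, f) \<and> (\<exists>s\<in>S. \<not> sat (S, f) s \<phi>))"
proof -
  define a where "a = t x"
  define S where "S = Pow (Atm - Dec)"
  define f where "f = (\<lambda>s. if q \<in> s then x else y)"
  define R where "R = BigConj (Pow {a}) (\<lambda>Y. Imp (cn Y {a}) (Box {} (Imp (cn Y {a}) (Atom a))))"
  have a: "a \<in> Atm" "a \<in> Dec"
    using assms t_in_Atm by (auto simp: a_def Dec_def)
  have true_a: "atom_true (S, f) s a \<longleftrightarrow> q \<in> s" for s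
    using assms a inj_t by (auto simp: atom_true_def f_def a_def inj_on_def)
  have "R \<in> lang"
    unfolding R_def Imp_def using a by (auto intro!: lang_BigConj lang.intros lang_cn)
  hence "Iff (Box {a} (Atom a)) R \<in> lang"
    using a by (auto simp: Iff_def Imp_def intro!: lang.intros)
  moreover have "BCL (Iff (Box {a} (Atom a)) R)"
    unfolding R_def using a by (auto intro: BCL.Red lang.intros)
  moreover have "classifier_model (S, f)"
    using assms by (auto simp: classifier_model_def S_def f_def)
  moreover have "{q} \<in> S" "{} \<in> S"
    using assms by (auto simp: S_def)
  moreover have "\<not> sat (S, f) {q} (Iff (Box {a} (Atom a)) R)"
  proof -
    have "sat (S, f) {q} R"
      by (auto simp: R_def Imp_def sat_BigConj sat_cn true_a subset_singleton_iff)
    moreover have "\<not> sat (S, f) {q} (Box {a} (Atom a))"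
      using \<open>{} \<in> S\<close> true_a assms a by auto
    ultimately show ?thesis by (auto simp: Iff_def Imp_def)
  qed
  ultimately show ?thesis by blast
qed

end

end

(* Completeness is proved syntactically: a function f from states to values is described by the
   boxed formula desc f, the box of the conjunction of cn Y (Atm - Dec) --> t (f Y) over all
   states Y. Some desc f holds: by Comp a world satisfying cn Y (Atm - Dec) is accessible, it
   satisfies some t x, so by Def it satisfies the box of cn Y (Atm - Dec) --> t x, and this box
   holds everywhere since the modality is S5. Finally, desc f together with cn Y (Atm - Dec)
   derivably decides every formula in agreement with its truth value at Y in the model of f;
   for a box one uses Red and desc f --> [{}] desc f, and Comp if the box is false. *)
theory Submission
  imports Defs
begin

section \<open>Truth values of derived connectives and finite conjunctions\<close>

lemma peval_connectives [simp]:
  "peval v (Imp \<phi> \<psi>) \<longleftrightarrow> (peval v \<phi> \<longrightarrow> peval v \<psi>)"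
  "peval v (Disj \<phi> \<psi>) \<longleftrightarrow> peval v \<phi> \<or> peval v \<psi>"
  "peval v (Iff \<phi> \<psi>) \<longleftrightarrow> (peval v \<phi> \<longleftrightarrow> peval v \<psi>)"
  "peval v (Dia X \<phi>) \<longleftrightarrow> \<not> v (Box X (Neg \<phi>))"
  by (auto simp: Imp_def Disj_def Iff_def Dia_def)

context bcl
begin

lemma peval_Top [simp]: "peval v Top"
  by (simp add: Top_def Let_def)

lemma peval_BigConj [simp]:
  assumes "finite I"
  shows "peval v (BigConj I F) \<longleftrightarrow> (\<forall>i\<in>I. peval v (F i))"
proof -
  have "peval v (foldr (\<lambda>i. Conj (F i)) is Top) \<longleftrightarrow> (\<forall>i\<in>set is. peval v (F i))" for "is"
    by (induction "is") auto
  with set_enum_of[OF assms] show ?thesis by (simp add: BigConj_def)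
qed

lemma peval_BigDisj [simp]:
  assumes "finite I"
  shows "peval v (BigDisj I F) \<longleftrightarrow> (\<exists>i\<in>I. peval v (F i))"
proof -
  have "peval v (foldr (\<lambda>i. Disj (F i)) is (Neg Top)) \<longleftrightarrow> (\<exists>i\<in>set is. peval v (F i))" for "is"
    by (induction "is") auto
  with set_enum_of[OF assms] show ?thesis by (simp add: BigDisj_def)
qed

lemma peval_cn:
  assumes "finite X" "Y \<subseteq> X"
  shows "peval v (cn Y X) \<longleftrightarrow> {p \<in> X. v (Atom p)} = Y"
  using assms finite_subset[of Y X] by (auto simp: cn_def)

text \<open>Both evaluations share the Boolean clauses, and atoms and boxes are read off the
  valuation. This makes tautologies sound and carries the evaluation lemmas for \<open>peval\<close>
  over to \<open>sat_dec\<close>.\<close>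

lemma peval_sat_dec: "peval (sat_dec C s) \<phi> \<longleftrightarrow> sat_dec C s \<phi>"
  by (induction \<phi>) auto

lemma sat_dec_connectives [simp]:
  "sat_dec C s (Imp \<phi> \<psi>) \<longleftrightarrow> (sat_dec C s \<phi> \<longrightarrow> sat_dec C s \<psi>)"
  "sat_dec C s (Iff \<phi> \<psi>) \<longleftrightarrow> (sat_dec C s \<phi> \<longleftrightarrow> sat_dec C s \<psi>)"
  "sat_dec C s (Dia {} \<phi>) \<longleftrightarrow> (\<exists>s'\<in>fst C. sat_dec C s' \<phi>)"
  by (auto simp: Imp_def Iff_def Dia_def)

lemma sat_dec_BigConj_BigDisj [simp]:
  assumes "finite I"
  shows "sat_dec C s (BigConj I F) \<longleftrightarrow> (\<forall>i\<in>I. sat_dec C s (F i))"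
    and "sat_dec C s (BigDisj I F) \<longleftrightarrow> (\<exists>i\<in>I. sat_dec C s (F i))"
  using peval_BigConj[OF assms, of "sat_dec C s" F] peval_BigDisj[OF assms, of "sat_dec C s" F]
  by (simp_all add: peval_sat_dec)

lemma sat_dec_cn:
  assumes "finite X" "Y \<subseteq> X"
  shows "sat_dec C s (cn Y X) \<longleftrightarrow> {p. atom_true C s p} \<inter> X = Y"
  using peval_cn[OF assms, of "sat_dec C s"] by (auto simp: peval_sat_dec)

section \<open>Soundness for the semantics comparing all atoms\<close>

lemma finite_states [simp]: "finite (Atm - Dec)"
  using finite_Atm by simp

lemma atom_true_state:
  assumes "s \<subseteq> Atm - Dec"
  shows "{p. atom_true C s p} \<inter> (Atm - Dec) = s"
  using assms by (auto simp: atom_true_def)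

lemma atom_true_t:
  assumes "x \<in> Val" "f s \<in> Val"
  shows "atom_true (S, f) s (t x) \<longleftrightarrow> f s = x"
  using assms inj_t by (auto simp: atom_true_def Dec_def inj_on_def)

text \<open>The state is generalized in the induction because necessitation passes from one state to
  all of them.\<close>

theorem soundness:
  assumes "BCL \<phi>" "classifier_model (S, f)" "s \<in> S"
  shows "sat_dec (S, f) s \<phi>"
  using assms(1,3)
proof (induction arbitrary: s)
  case (Taut \<phi>)
  then show ?case unfolding tautology_def using peval_sat_dec by blast
next
  case (Red \<phi> X)
  then have fin: "finite X" using finite_Atm by (meson finite_subset)
  \<comment> \<open>Only the conjunct for the set \<open>Y\<close> of atoms of \<open>X\<close> true
    at \<open>s\<close> has a true antecedent, and that conjunct is the clause of
    \<open>sat_dec\<close> for \<open>Box X\<close>.\<close>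
  have "sat_dec (S, f) s (BigConj (Pow X) (\<lambda>Y. Imp (cn Y X) (Box {} (Imp (cn Y X) \<phi>)))) \<longleftrightarrow>
      (\<forall>Y\<in>Pow X. {p. atom_true (S, f) s p} \<inter> X = Y \<longrightarrow>
        (\<forall>s'\<in>S. {p. atom_true (S, f) s' p} \<inter> X = Y \<longrightarrow> sat_dec (S, f) s' \<phi>))"
    using fin by (simp add: sat_dec_cn)
  also have "\<dots> \<longleftrightarrow> sat_dec (S, f) s (Box X \<phi>)"
    unfolding sat_dec.simps(4) fst_conv by blast
  finally show ?case by simp
next
  case AtLeast
  then have "f s \<in> Val" using assms(2) by (auto simp: classifier_model_def)
  then show ?case by (auto simp: finite_Val atom_true_t)
next
  case (AtMost x y)
  then have "f s \<in> Val" using assms(2) by (auto simp: classifier_model_def)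
  with AtMost show ?case by (simp add: atom_true_t)
next
  case (Def x)
  have S: "s \<subseteq> Atm - Dec" "f s \<in> Val" if "s \<in> S" for s
    using that assms(2) by (auto simp: classifier_model_def)
  \<comment> \<open>The formula \<open>cn Y (Atm - Dec)\<close> holds at the state \<open>Y\<close>
    only, so the box speaks of the same state and hence of the same value.\<close>
  then show ?case using Def by (simp add: sat_dec_cn atom_true_state atom_true_t)
next
  case Comp
  have S: "S = Pow (Atm - Dec)" using assms(2) by (simp add: classifier_model_def)
  have "sat_dec (S, f) Y (cn Y (Atm - Dec))" if "Y \<subseteq> Atm - Dec" for Y
    using that by (simp add: sat_dec_cn atom_true_state)
  then show ?case using S by auto
qed auto

end

text \<open>\<open>Top\<close> is built from an atom, so without atoms the axioms
  \<open>AtLeast\<close> and \<open>Comp\<close> would fall outside \<open>lang\<close>. Any formula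
  in \<open>lang\<close> supplies an atom.\<close>

locale bcl_nonempty = bcl +
  assumes Atm_nonempty: "Atm \<noteq> {}"
begin

section \<open>Membership in the language and derived rules\<close>

lemma lang_Neg [simp]: "Neg \<phi> \<in> lang \<longleftrightarrow> \<phi> \<in> lang"
  and lang_Conj [simp]: "Conj \<phi> \<psi> \<in> lang \<longleftrightarrow> \<phi> \<in> lang \<and> \<psi> \<in> lang"
  and lang_Box [simp]: "Box X \<phi> \<in> lang \<longleftrightarrow> X \<subseteq> Atm \<and> \<phi> \<in> lang"
  and lang_Atom [simp]: "Atom p \<in> lang \<longleftrightarrow> p \<in> Atm"
  by (auto intro: lang.intros elim: lang.cases)

lemma lang_connectives [simp]:
  "Imp \<phi> \<psi> \<in> lang \<longleftrightarrow> \<phi> \<in> lang \<and> \<psi> \<in> lang"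
  "Disj \<phi> \<psi> \<in> lang \<longleftrightarrow> \<phi> \<in> lang \<and> \<psi> \<in> lang"
  "Iff \<phi> \<psi> \<in> lang \<longleftrightarrow> \<phi> \<in> lang \<and> \<psi> \<in> lang"
  "Dia X \<phi> \<in> lang \<longleftrightarrow> X \<subseteq> Atm \<and> \<phi> \<in> lang"
  by (auto simp: Imp_def Disj_def Iff_def Dia_def)

lemma lang_Top [simp]: "Top \<in> lang"
  using Atm_nonempty by (simp add: Top_def Let_def some_in_eq)

lemma lang_BigDisj:
  assumes "finite I" "\<And>i. i \<in> I \<Longrightarrow> F i \<in> lang"
  shows "BigDisj I F \<in> lang"
proof -
  have "set is \<subseteq> I \<Longrightarrow> foldr (\<lambda>i. Disj (F i)) is (Neg Top) \<in> lang" for "is"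
    using assms(2) by (induction "is") auto
  with set_enum_of[OF assms(1)] show ?thesis by (simp add: BigDisj_def)
qed

lemma t_in_lang: "x \<in> Val \<Longrightarrow> t x \<in> Atm"
  using t_in_Atm by auto

lemmas lang_intros = lang_BigConj[OF _ Atm_nonempty] lang_BigDisj lang_cn[OF _ _ Atm_nonempty]
  t_in_lang

lemma BCL_lang: "BCL \<phi> \<Longrightarrow> \<phi> \<in> lang"
proof (induction rule: BCL.induct)
  case (Red \<phi> X)
  have "finite X" using Red finite_Atm by (meson finite_subset)
  with Red show ?case by (auto intro!: lang_intros)
qed (auto intro!: lang_intros simp: finite_Val)

text \<open>Premises move one by one to the left of an implication until a tautology remains; modus
  ponens then discharges them. Boxed formulas count as atoms here, so every modal fact has to be
  listed in \<open>G\<close>.\<close>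

lemma BCL_consequence:
  assumes "finite G" "\<forall>\<gamma>\<in>G. BCL \<gamma>" "\<phi> \<in> lang"
    and "\<And>v. \<forall>\<gamma>\<in>G. peval v \<gamma> \<Longrightarrow> peval v \<phi>"
  shows "BCL \<phi>"
  using assms
proof (induction G arbitrary: \<phi> rule: finite_induct)
  case empty
  then show ?case by (auto intro: BCL.Taut simp: tautology_def)
next
  case (insert \<gamma> G)
  have "BCL (Imp \<gamma> \<phi>)"
    using insert.prems by (intro insert.IH) (auto dest: BCL_lang)
  with insert.prems(1) show ?case by (blast intro: BCL.MP)
qed

lemma BCL_Box_mono:
  assumes "BCL (Imp \<phi> \<psi>)"
  shows "BCL (Imp (Box {} \<phi>) (Box {} \<psi>))"
proof (rule BCL_consequence)
  let ?G = "{Imp (Conj (Box {} \<phi>) (Box {} (Imp \<phi> \<psi>))) (Box {} \<psi>), Box {} (Imp \<phi> \<psi>)}"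
  show "\<forall>\<gamma>\<in>?G. BCL \<gamma>"
    using assms BCL_lang[OF assms] by (auto intro: BCL.K BCL.Nec)
qed (use BCL_lang[OF assms] in auto)

text \<open>Axiom 5 from 4 and B: the contrapositive of 4 leads from
  \<open>Dia {} (Neg (Box {} \<phi>))\<close> to \<open>Neg (Box {} \<phi>)\<close>. Boxing this and
  composing it with B for \<open>Neg (Box {} \<phi>)\<close> gives the claim.\<close>

lemma BCL_five:
  assumes "\<phi> \<in> lang"
  shows "BCL (Imp (Neg (Box {} \<phi>)) (Box {} (Neg (Box {} \<phi>))))"
proof -
  let ?n = "Neg (Box {} \<phi>)"
  \<comment> \<open>\<open>Dia {} ?n\<close> hides a double negation under its box, so
    \<open>Box {} (Box {} \<phi>)\<close> must first be turned into
    \<open>Box {} (Neg ?n)\<close>.\<close>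
  have "BCL (Imp (Box {} \<phi>) (Neg ?n))"
    using assms by (auto intro!: BCL.Taut simp: tautology_def)
  then have 1: "BCL (Imp (Box {} (Box {} \<phi>)) (Box {} (Neg ?n)))"
    by (rule BCL_Box_mono)
  have 2: "BCL (Imp (Dia {} ?n) ?n)"
    using 1 BCL.Four[OF assms] assms
    by (intro BCL_consequence[of "{Imp (Box {} (Box {} \<phi>)) (Box {} (Neg ?n)),
          Imp (Box {} \<phi>) (Box {} (Box {} \<phi>))}"]) auto
  show ?thesis
    using BCL_Box_mono[OF 2] BCL.B[of ?n] assms
    by (intro BCL_consequence[of "{Imp (Box {} (Dia {} ?n)) (Box {} ?n),
          Imp ?n (Box {} (Dia {} ?n))}"]) auto
qed

text \<open>The induction runs over arbitrary lists, since the enumerations that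
  \<open>enum_of\<close> chooses for a set and for a smaller set are unrelated. Each step combines
  two boxes by K.\<close>

lemma BCL_Box_BigConj:
  assumes "finite I" "\<And>i. i \<in> I \<Longrightarrow> F i \<in> lang"
  shows "BCL (Imp (BigConj I (\<lambda>i. Box {} (F i))) (Box {} (BigConj I F)))"
proof -
  let ?C = "\<lambda>F is. foldr (\<lambda>i. Conj (F i)) is Top"
  have lang: "?C F is \<in> lang" if "\<And>i. i \<in> set is \<Longrightarrow> F i \<in> lang" for F and "is" :: "'c list"
    using that by (induction "is") auto
  have "BCL (Imp (?C (\<lambda>i. Box {} (F i)) is) (Box {} (?C F is)))" if "set is \<subseteq> I" for "is"
    using that
  proof (induction "is")
    case Nil
    have "BCL (Box {} Top)"
      by (intro BCL.Nec BCL.Taut) (auto simp: tautology_def)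
    then show ?case by (intro BCL_consequence[of "{Box {} Top}"]) auto
  next
    case (Cons i "is")
    let ?r = "?C F is"
    have in_lang: "F i \<in> lang" "?r \<in> lang" "?C (\<lambda>i. Box {} (F i)) is \<in> lang"
      using Cons.prems assms(2) by (auto intro!: lang)
    have "BCL (Imp (F i) (Imp ?r (Conj (F i) ?r)))"
      using in_lang by (auto intro!: BCL.Taut simp: tautology_def)
    then have 1: "BCL (Imp (Box {} (F i)) (Box {} (Imp ?r (Conj (F i) ?r))))"
      by (rule BCL_Box_mono)
    have 2: "BCL (Imp (Conj (Box {} ?r) (Box {} (Imp ?r (Conj (F i) ?r)))) (Box {} (Conj (F i) ?r)))"
      using in_lang by (intro BCL.K) auto
    show ?case
      using 1 2 Cons in_lang
      by (intro BCL_consequence[of "{Imp (Box {} (F i)) (Box {} (Imp ?r (Conj (F i) ?r))),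
         Imp (Conj (Box {} ?r) (Box {} (Imp ?r (Conj (F i) ?r)))) (Box {} (Conj (F i) ?r)),
         Imp (?C (\<lambda>i. Box {} (F i)) is) (Box {} ?r)}"]) auto
  qed
  from this[of "enum_of I"] show ?thesis
    using set_enum_of[OF assms(1)] by (simp add: BigConj_def)
qed

section \<open>Descriptions of classifiers by formulas\<close>

abbreviation state :: "'a set \<Rightarrow> 'a fm" where
  "state Y \<equiv> cn Y (Atm - Dec)"

abbreviation value_at :: "'a set \<Rightarrow> 'b \<Rightarrow> 'a fm" where
  "value_at Y x \<equiv> Imp (state Y) (Atom (t x))"

definition desc :: "('a set \<Rightarrow> 'b) \<Rightarrow> 'a fm" where
  "desc f = Box {} (BigConj (Pow (Atm - Dec)) (\<lambda>Y. value_at Y (f Y)))"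

lemma lang_state [simp]: "Y \<subseteq> Atm - Dec \<Longrightarrow> state Y \<in> lang"
  by (intro lang_intros) auto

lemma peval_state: "Y \<subseteq> Atm - Dec \<Longrightarrow> peval v (state Y) \<longleftrightarrow> {p \<in> Atm - Dec. v (Atom p)} = Y"
  by (intro peval_cn) auto

lemma lang_desc:
  assumes "f \<in> Pow (Atm - Dec) \<rightarrow> Val"
  shows "desc f \<in> lang"
  unfolding desc_def using assms by (auto intro!: lang_intros)

lemma BCL_Comp_state:
  assumes "Y \<subseteq> Atm - Dec"
  shows "BCL (Dia {} (state Y))"
  using assms BCL.Comp
  by (intro BCL_consequence[of "{BigConj (Pow (Atm - Dec)) (\<lambda>Y. Dia {} (state Y))}"]) auto

text \<open>The derivation runs contrapositively. If every \<open>Box {} (value_at Y x)\<close>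
  fails, axiom 5 makes all these failures necessary; jointly they refute \<open>state Y\<close>,
  whose negation is then necessary, against \<open>Comp\<close>.\<close>

lemma BCL_ex_value:
  assumes Y: "Y \<subseteq> Atm - Dec"
  shows "BCL (BigDisj Val (\<lambda>x. Box {} (value_at Y x)))"
proof -
  let ?D = "\<lambda>x. BigConj (Pow (Atm - Dec)) (\<lambda>Y. Imp (Conj (state Y) (Atom (t x)))
        (Box {} (value_at Y x)))"
  let ?n = "\<lambda>x. Neg (Box {} (value_at Y x))"
  let ?N = "BigConj Val ?n"
  have in_lang: "?N \<in> lang" using Y by (auto intro!: lang_intros simp: finite_Val)
  have "BCL (Imp ?N (Neg (state Y)))"
  proof (rule BCL_consequence)
    let ?G = "insert (BigDisj Val (\<lambda>x. Atom (t x))) (?D ` Val)"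
    show "\<forall>\<gamma>\<in>?G. BCL \<gamma>"
      using BCL.AtLeast BCL.Def by auto
    show "peval v (Imp ?N (Neg (state Y)))" if G: "\<forall>\<gamma>\<in>?G. peval v \<gamma>" for v
    proof -
      \<comment> \<open>\<open>AtLeast\<close> supplies a value true under \<open>v\<close>; if
        \<open>state Y\<close> held too, \<open>Def\<close> would yield a box that \<open>?N\<close>
        denies.\<close>
      obtain x where x: "x \<in> Val" "v (Atom (t x))"
        using G by (auto simp: finite_Val)
      then have "peval v (?D x)" using G by blast
      then have "peval v (state Y) \<Longrightarrow> v (Box {} (value_at Y x))"
        using x Y by simp
      with x show ?thesis by (auto simp: finite_Val)
    qed
  qed (use Y in_lang in \<open>auto simp: finite_Val\<close>)
  then have 1: "BCL (Imp (Box {} ?N) (Box {} (Neg (state Y))))"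
    by (rule BCL_Box_mono)
  have 2: "BCL (Imp (BigConj Val (\<lambda>x. Box {} (?n x))) (Box {} ?N))"
    using Y by (intro BCL_Box_BigConj) (auto simp: finite_Val t_in_lang)
  let ?F = "(\<lambda>x. Imp (?n x) (Box {} (?n x))) ` Val"
  let ?G = "{Imp (Box {} ?N) (Box {} (Neg (state Y))),
     Imp (BigConj Val (\<lambda>x. Box {} (?n x))) (Box {} ?N), Dia {} (state Y)}"
  show ?thesis
  proof (rule BCL_consequence)
    show "\<forall>\<gamma>\<in>?G \<union> ?F. BCL \<gamma>"
      using 1 2 BCL_Comp_state Y by (auto intro!: BCL_five simp: t_in_lang)
    show "peval v (BigDisj Val (\<lambda>x. Box {} (value_at Y x)))"
      if "\<forall>\<gamma>\<in>?G \<union> ?F. peval v \<gamma>" for v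
      using that by (auto simp: finite_Val)
  qed (use Y in \<open>auto simp: finite_Val intro!: lang_intros\<close>)
qed

lemma BCL_desc_value:
  assumes f: "f \<in> Pow (Atm - Dec) \<rightarrow> Val" and Y: "Y \<subseteq> Atm - Dec"
  shows "BCL (Imp (Conj (desc f) (state Y)) (Atom (t (f Y))))"
proof -
  let ?C = "BigConj (Pow (Atm - Dec)) (\<lambda>Y. value_at Y (f Y))"
  have "BCL (Imp (desc f) ?C)"
    using lang_desc[OF f] unfolding desc_def by (intro BCL.T) auto
  then show ?thesis
    using lang_desc[OF f] f Y
    by (intro BCL_consequence[of "{Imp (desc f) ?C}"]) (auto intro!: t_in_lang)
qed

section \<open>Formulas decided by a classifier and a state\<close>

abbreviation model :: "('a set \<Rightarrow> 'b) \<Rightarrow> 'a set set \<times> ('a set \<Rightarrow> 'b)" where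
  "model f \<equiv> (Pow (Atm - Dec), f)"

text \<open>The shape of Kalmar's lemma for propositional logic: \<open>desc f\<close> and
  \<open>state Y\<close> replace the literals fixed by a valuation, and the truth value comes from
  the model.\<close>

definition decides :: "('a set \<Rightarrow> 'b) \<Rightarrow> 'a set \<Rightarrow> 'a fm \<Rightarrow> bool" where
  "decides f Y \<phi> \<longleftrightarrow>
    BCL (Imp (Conj (desc f) (state Y)) (if sat_dec (model f) Y \<phi> then \<phi> else Neg \<phi>))"

text \<open>A valuation satisfying \<open>desc f\<close>, \<open>state Y\<close> and the theorems
  behind \<open>decides\<close> must give each formula in \<open>G\<close> its semantic value at
  \<open>Y\<close>, so propositional reasoning may use these values. \<open>H\<close> holds
  additional theorems.\<close>

lemma decides_consequence:
  assumes f: "f \<in> Pow (Atm - Dec) \<rightarrow> Val" and Y: "Y \<subseteq> Atm - Dec"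
    and "finite G" "\<forall>\<gamma>\<in>G. decides f Y \<gamma>"
    and "finite H" "\<forall>\<gamma>\<in>H. BCL \<gamma>"
    and "\<phi> \<in> lang"
    and ev: "\<And>v. peval v (desc f) \<Longrightarrow> peval v (state Y)
      \<Longrightarrow> \<forall>\<gamma>\<in>G. peval v \<gamma> \<longleftrightarrow> sat_dec (model f) Y \<gamma>
      \<Longrightarrow> \<forall>\<gamma>\<in>H. peval v \<gamma> \<Longrightarrow> peval v \<phi>"
  shows "BCL (Imp (Conj (desc f) (state Y)) \<phi>)"
proof (rule BCL_consequence)
  let ?h = "\<lambda>\<gamma>. Imp (Conj (desc f) (state Y)) (if sat_dec (model f) Y \<gamma> then \<gamma> else Neg \<gamma>)"
  show "finite (?h ` G \<union> H)" using assms by simp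
  show "\<forall>\<gamma>\<in>?h ` G \<union> H. BCL \<gamma>"
    using assms by (auto simp: decides_def)
  show "Imp (Conj (desc f) (state Y)) \<phi> \<in> lang"
    using assms by (simp add: lang_desc)
  show "peval v (Imp (Conj (desc f) (state Y)) \<phi>)" if G: "\<forall>\<gamma>\<in>?h ` G \<union> H. peval v \<gamma>" for v
  proof -
    have "peval v \<phi>" if "peval v (desc f)" "peval v (state Y)"
    proof (rule ev)
      show "\<forall>\<gamma>\<in>G. peval v \<gamma> \<longleftrightarrow> sat_dec (model f) Y \<gamma>"
      proof
        fix \<gamma> assume "\<gamma> \<in> G"
        then have "peval v (?h \<gamma>)" using G by blast
        then show "peval v \<gamma> \<longleftrightarrow> sat_dec (model f) Y \<gamma>"
          using that by (simp split: if_splits)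
      qed
    qed (use that G in auto)
    then show ?thesis by simp
  qed
qed

text \<open>A non-decision atom or its negation is a conjunct of \<open>state Y\<close>. For
  decision atoms, \<open>desc f\<close> yields \<open>t (f Y)\<close>, and \<open>AtMost\<close>
  excludes the other values.\<close>

lemma decides_Atom:
  assumes f: "f \<in> Pow (Atm - Dec) \<rightarrow> Val" and Y: "Y \<subseteq> Atm - Dec" and p: "p \<in> Atm"
  shows "decides f Y (Atom p)"
proof (cases "p \<in> Dec")
  case True
  then obtain x where x: "x \<in> Val" "p = t x" by (auto simp: Dec_def)
  have fY: "f Y \<in> Val" using f Y by auto
  show ?thesis
  proof (cases "f Y = x")
    case True
    then show ?thesis using BCL_desc_value[OF f Y] x fY
      by (simp add: decides_def atom_true_t)
  next
    case False
    have "BCL (Imp (Conj (desc f) (state Y)) (Neg (Atom (t x))))"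
      using BCL_desc_value[OF f Y] BCL.AtMost[OF fY x(1) False] lang_desc[OF f] Y x
      by (intro BCL_consequence[of "{Imp (Conj (desc f) (state Y)) (Atom (t (f Y))),
           Imp (Atom (t (f Y))) (Neg (Atom (t x)))}"]) (auto simp: t_in_lang)
    then show ?thesis using False x fY by (simp add: decides_def atom_true_t)
  qed
next
  case False
  with p Y show ?thesis
    unfolding decides_def
    by (intro BCL.Taut) (auto simp: tautology_def lang_desc[OF f] peval_state atom_true_def)
qed

text \<open>The truth value of \<open>cn Z X\<close> depends only on the atoms of \<open>X\<close>,
  and all of these are decided, decision atoms included.\<close>

lemma decides_cn:
  assumes f: "f \<in> Pow (Atm - Dec) \<rightarrow> Val" and Y: "Y \<subseteq> Atm - Dec"
    and X: "X \<subseteq> Atm" "Z \<subseteq> X"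
  shows "decides f Y (cn Z X)"
  unfolding decides_def
proof (rule decides_consequence[OF f Y])
  have fin: "finite X" using X finite_Atm by (meson finite_subset)
  show "finite (Atom ` X)" using fin by simp
  show "\<forall>\<gamma>\<in>Atom ` X. decides f Y \<gamma>"
    using X f Y by (auto intro!: decides_Atom)
  show "finite {}" "\<forall>\<gamma>\<in>{}. BCL \<gamma>" by auto
  show "(if sat_dec (model f) Y (cn Z X) then cn Z X else Neg (cn Z X)) \<in> lang"
    using X lang_intros by auto
  fix v assume "\<forall>\<gamma>\<in>Atom ` X. peval v \<gamma> \<longleftrightarrow> sat_dec (model f) Y \<gamma>"
  then have "{p \<in> X. v (Atom p)} = {p. atom_true (model f) Y p} \<inter> X" by auto
  then show "peval v (if sat_dec (model f) Y (cn Z X) then cn Z X else Neg (cn Z X))"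
    using fin X by (simp add: peval_cn sat_dec_cn)
qed

text \<open>Necessitation under \<open>desc f\<close>, which is itself a boxed formula.\<close>

lemma BCL_desc_Nec:
  assumes "BCL (Imp (desc f) \<phi>)"
  shows "BCL (Imp (desc f) (Box {} \<phi>))"
proof -
  have lang: "desc f \<in> lang" "\<phi> \<in> lang" using BCL_lang[OF assms] by auto
  have "BCL (Imp (desc f) (Box {} (desc f)))"
    unfolding desc_def using lang(1) by (intro BCL.Four) (simp add: desc_def)
  with BCL_Box_mono[OF assms] lang show ?thesis
    by (intro BCL_consequence[of "{Imp (desc f) (Box {} (desc f)),
          Imp (Box {} (desc f)) (Box {} \<phi>)}"]) auto
qed

text \<open>Every valuation satisfies the state formula of its true non-decision atoms, so the cases
  are exhaustive by propositional logic alone.\<close>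

lemma BCL_state_cases:
  assumes "\<phi> \<in> lang" "\<psi> \<in> lang"
    and "\<And>Y. Y \<subseteq> Atm - Dec \<Longrightarrow> BCL (Imp (Conj \<psi> (state Y)) \<phi>)"
  shows "BCL (Imp \<psi> \<phi>)"
proof (rule BCL_consequence)
  let ?G = "(\<lambda>Y. Imp (Conj \<psi> (state Y)) \<phi>) ` Pow (Atm - Dec)"
  show "peval v (Imp \<psi> \<phi>)" if "\<forall>\<gamma>\<in>?G. peval v \<gamma>" for v
  proof -
    let ?Y = "{p \<in> Atm - Dec. v (Atom p)}"
    have Y: "?Y \<subseteq> Atm - Dec" by auto
    then have "peval v (Imp (Conj \<psi> (state ?Y)) \<phi>)" using that by blast
    then show ?thesis using peval_state[OF Y, of v] by simp
  qed
qed (use assms in auto)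

text \<open>Given \<open>desc f\<close> and \<open>state Y\<close>, \<open>Red\<close> collapses
  \<open>Box X \<phi>\<close> to \<open>Box {} (Imp (cn Z X) \<phi>)\<close> for a single
  \<open>Z\<close>. That box is settled by the values of its body at all states, which
  \<open>IH\<close> and \<open>decides_cn\<close> provide.\<close>

lemma decides_Box:
  assumes f: "f \<in> Pow (Atm - Dec) \<rightarrow> Val" and Y: "Y \<subseteq> Atm - Dec"
    and X: "X \<subseteq> Atm" and \<phi>: "\<phi> \<in> lang"
    and IH: "\<And>Y. Y \<subseteq> Atm - Dec \<Longrightarrow> decides f Y \<phi>"
  shows "decides f Y (Box X \<phi>)"
proof -
  \<comment> \<open>The truth pattern of \<open>Y\<close> on \<open>X\<close>, which selects the one
    relevant conjunct of \<open>Red\<close>; a decision atom in \<open>X\<close> enters through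
    \<open>f Y\<close>.\<close>
  define Z where "Z = {p. atom_true (model f) Y p} \<inter> X"
  have fin: "finite X" using X finite_Atm by (meson finite_subset)
  have Z: "Z \<subseteq> X" by (auto simp: Z_def)
  let ?\<chi> = "Imp (cn Z X) \<phi>"
  let ?R = "BigConj (Pow X) (\<lambda>Z. Imp (cn Z X) (Box {} (Imp (cn Z X) \<phi>)))"
  have \<chi>: "?\<chi> \<in> lang" using X Z \<phi> by (auto intro!: lang_intros)
  have red: "BCL (Iff (Box X \<phi>) ?R)" using \<phi> X by (rule BCL.Red)
  have cn_iff: "sat_dec (model f) Y' (cn Z' X) \<longleftrightarrow> {p. atom_true (model f) Y' p} \<inter> X = Z'"
    if "Z' \<subseteq> X" for Z' Y'
    using fin that by (rule sat_dec_cn)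
  \<comment> \<open>Replaces \<open>Box X \<phi>\<close> with \<open>Box {} ?\<chi>\<close>. Here
    \<open>\<eta>\<close> stands for the implication from \<open>desc f\<close> obtained in each of
    the two cases below.\<close>
  have step: "BCL (Imp (Conj (desc f) (state Y)) \<theta>)"
    if H: "BCL \<eta>" "\<theta> \<in> lang"
      "\<And>v. peval v (desc f) \<Longrightarrow> peval v \<eta> \<Longrightarrow> v (Box X \<phi>) = v (Box {} ?\<chi>) \<Longrightarrow> peval v \<theta>" for \<eta> \<theta>
  proof (rule decides_consequence[OF f Y])
    let ?G = "(\<lambda>Z. cn Z X) ` Pow X" and ?H = "{\<eta>, Iff (Box X \<phi>) ?R}"
    show "finite ?G" using fin by simp
    show "\<forall>\<gamma>\<in>?G. decides f Y \<gamma>"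
      using decides_cn[OF f Y X] by auto
    show "finite ?H" by simp
    show "\<forall>\<gamma>\<in>?H. BCL \<gamma>"
      using H red by simp
    show "\<theta> \<in> lang" by fact
    fix v assume v: "peval v (desc f)" "\<forall>\<gamma>\<in>?G. peval v \<gamma> \<longleftrightarrow> sat_dec (model f) Y \<gamma>"
      "\<forall>\<gamma>\<in>?H. peval v \<gamma>"
    have "peval v (cn Z' X) \<longleftrightarrow> Z' = Z" if "Z' \<subseteq> X" for Z'
      using v(2) cn_iff[OF that, of Y] that by (auto simp: Z_def)
    moreover have "v (Box X \<phi>) \<longleftrightarrow> peval v ?R"
      using v(3) by simp
    ultimately have "v (Box X \<phi>) = v (Box {} ?\<chi>)"
      using fin Z by auto
    then show "peval v \<theta>" using H(3) v by auto
  qed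
  \<comment> \<open>The state \<open>Y'\<close> varies, but \<open>Z\<close> remains the pattern
    computed at \<open>Y\<close>.\<close>
  have here: "BCL (Imp (Conj (desc f) (state Y')) (if sat_dec (model f) Y' ?\<chi> then ?\<chi> else Neg ?\<chi>))"
    if Y': "Y' \<subseteq> Atm - Dec" for Y'
    using IH[OF Y'] decides_cn[OF f Y' X Z] \<chi>
    by (intro decides_consequence[OF f Y', of "{\<phi>, cn Z X}" "{}"]) auto
  have sat_Box: "sat_dec (model f) Y (Box X \<phi>) \<longleftrightarrow> (\<forall>Y'\<subseteq>Atm - Dec. sat_dec (model f) Y' ?\<chi>)"
    using cn_iff[OF Z] by (auto simp: Z_def)
  show ?thesis
  proof (cases "sat_dec (model f) Y (Box X \<phi>)")
    case True
    then have all: "sat_dec (model f) Y' ?\<chi>" if "Y' \<subseteq> Atm - Dec" for Y'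
      using that sat_Box by blast
    \<comment> \<open>The case distinction removes the state formula, leaving only a premise under
      which necessitation is available.\<close>
    have "BCL (Imp (desc f) ?\<chi>)"
    proof (rule BCL_state_cases[OF \<chi> lang_desc[OF f]])
      show "BCL (Imp (Conj (desc f) (state Y')) ?\<chi>)" if "Y' \<subseteq> Atm - Dec" for Y'
        using here[OF that] all[OF that] by (simp only: if_True)
    qed
    then have "BCL (Imp (desc f) (Box {} ?\<chi>))" by (rule BCL_desc_Nec)
    then have "BCL (Imp (Conj (desc f) (state Y)) (Box X \<phi>))"
      by (rule step) (use \<phi> X in auto)
    with True show ?thesis unfolding decides_def by (simp only: if_True)
  next
    case False
    then obtain Y' where Y': "Y' \<subseteq> Atm - Dec" "\<not> sat_dec (model f) Y' ?\<chi>"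
      using sat_Box by blast
    let ?n = "Neg (state Y')"
    \<comment> \<open>As \<open>?\<chi>\<close> is refuted at \<open>Y'\<close>, it excludes
      \<open>state Y'\<close>. After boxing, \<open>Box {} ?\<chi>\<close> would make
      \<open>?n\<close> necessary, which \<open>Comp\<close> forbids.\<close>
    have "BCL (Imp (desc f) (Imp ?\<chi> ?n))"
      using here[OF Y'(1)] Y' \<chi> lang_desc[OF f]
      by (intro BCL_consequence[of "{Imp (Conj (desc f) (state Y')) (Neg ?\<chi>)}"]) auto
    then have 1: "BCL (Imp (desc f) (Box {} (Imp ?\<chi> ?n)))" by (rule BCL_desc_Nec)
    have 2: "BCL (Imp (Conj (Box {} ?\<chi>) (Box {} (Imp ?\<chi> ?n))) (Box {} ?n))"
      using \<chi> Y' by (intro BCL.K) auto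
    have "BCL (Imp (desc f) (Neg (Box {} ?\<chi>)))"
      using 1 2 BCL_Comp_state[OF Y'(1)] \<chi> lang_desc[OF f]
      by (intro BCL_consequence[of "{Imp (desc f) (Box {} (Imp ?\<chi> ?n)),
           Imp (Conj (Box {} ?\<chi>) (Box {} (Imp ?\<chi> ?n))) (Box {} ?n), Dia {} (state Y')}"]) auto
    then have "BCL (Imp (Conj (desc f) (state Y)) (Neg (Box X \<phi>)))"
      by (rule step) (use \<phi> X in auto)
    with False show ?thesis unfolding decides_def by (simp only: if_False)
  qed
qed

text \<open>\<open>Y\<close> is generalized because a box needs its body decided at every
  state.\<close>

lemma decides_formula:
  assumes "\<phi> \<in> lang" "f \<in> Pow (Atm - Dec) \<rightarrow> Val" "Y \<subseteq> Atm - Dec"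
  shows "decides f Y \<phi>"
  using assms(1,3)
proof (induction arbitrary: Y)
  case (1 p)
  with assms(2) show ?case by (intro decides_Atom)
next
  case (2 \<phi>)
  then show ?case unfolding decides_def[of _ _ "Neg \<phi>"]
    by (intro decides_consequence[OF assms(2), of _ "{\<phi>}" "{}"]) auto
next
  case (3 \<phi> \<psi>)
  then show ?case unfolding decides_def[of _ _ "Conj \<phi> \<psi>"]
    by (intro decides_consequence[OF assms(2), of _ "{\<phi>, \<psi>}" "{}"]) auto
next
  case (4 X \<phi>)
  with assms(2) show ?case by (intro decides_Box)
qed

section \<open>Exhaustion of all classifiers and completeness\<close>

lemma BCL_desc_cases:
  assumes "\<phi> \<in> lang"
    and "\<And>f. f \<in> Pow (Atm - Dec) \<rightarrow> Val \<Longrightarrow> BCL (Imp (desc f) \<phi>)"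
  shows "BCL \<phi>"
proof (rule BCL_consequence)
  let ?S = "Pow (Atm - Dec)"
  \<comment> \<open>Extensional functions keep the family finite, as \<open>BCL_consequence\<close>
    demands finitely many premises.\<close>
  let ?F = "PiE ?S (\<lambda>_. Val)"
  let ?V = "\<lambda>Y. BigDisj Val (\<lambda>x. Box {} (value_at Y x))"
  let ?C = "\<lambda>f. Imp (BigConj ?S (\<lambda>Y. Box {} (value_at Y (f Y)))) (desc f)"
  let ?G = "(\<lambda>f. Imp (desc f) \<phi>) ` ?F \<union> ?C ` ?F \<union> ?V ` ?S"
  show "finite ?G"
    by (intro finite_UnI finite_imageI finite_PiE) (auto simp: finite_Val)
  have C: "BCL (?C f)" if "f \<in> ?F" for f
    unfolding desc_def using that by (intro BCL_Box_BigConj) (auto intro!: t_in_lang)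
  have "BCL (Imp (desc f) \<phi>)" if "f \<in> ?F" for f
    using that by (intro assms(2)) auto
  then show "\<forall>\<gamma>\<in>?G. BCL \<gamma>"
    using C BCL_ex_value by blast
  show "peval v \<phi>" if G: "\<forall>\<gamma>\<in>?G. peval v \<gamma>" for v
  proof -
    have "peval v (?V Y)" if "Y \<in> ?S" for Y using G that by blast
    then have "\<exists>x\<in>Val. v (Box {} (value_at Y x))" if "Y \<in> ?S" for Y
      using that by (simp add: finite_Val)
    \<comment> \<open>The true disjunctions \<open>?V Y\<close> let a value be chosen at each state;
      the chosen boxes together give a true description through \<open>?C\<close>.\<close>
    then obtain g where g: "\<And>Y. Y \<in> ?S \<Longrightarrow> g Y \<in> Val \<and> v (Box {} (value_at Y (g Y)))"
      by metis
    \<comment> \<open>Restriction places the function in \<open>?F\<close> without changing its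
      values at states.\<close>
    define f where "f = restrict g ?S"
    have f: "f \<in> ?F" using g by (auto simp: f_def)
    have "peval v (?C f)" "peval v (Imp (desc f) \<phi>)" using G f by blast+
    then show ?thesis using g by (simp add: f_def)
  qed
qed fact

text \<open>The distinctions over descriptions and states leave pairs \<open>f\<close>,
  \<open>Y\<close> at which \<open>\<phi>\<close> is decided, and validity makes the decided value
  true.\<close>

theorem completeness:
  assumes "\<phi> \<in> lang"
    and "\<And>S f s. classifier_model (S, f) \<Longrightarrow> s \<in> S \<Longrightarrow> sat_dec (S, f) s \<phi>"
  shows "BCL \<phi>"
proof (rule BCL_desc_cases[OF assms(1)])
  fix f assume f: "f \<in> Pow (Atm - Dec) \<rightarrow> Val"
  show "BCL (Imp (desc f) \<phi>)"
  proof (rule BCL_state_cases)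
    fix Y assume Y: "Y \<subseteq> Atm - Dec"
    then have "sat_dec (model f) Y \<phi>"
      using f by (intro assms(2)) (auto simp: classifier_model_def)
    with decides_formula[OF assms(1) f Y] show "BCL (Imp (Conj (desc f) (state Y)) \<phi>)"
      by (simp add: decides_def)
  qed (use assms(1) lang_desc[OF f] in auto)
qed

end

text \<open>A derivation may pass through boxes over decision atoms even if its conclusion has none,
  so the equivalence for \<open>sat\<close> is obtained from that for \<open>sat_dec\<close>,
  comparing the two relations only at \<open>\<phi>\<close>. The restriction on modalities rules out
  formulas such as those built in \<open>Red_unsound\<close>.\<close>

theorem theorem1:
  fixes Atm :: "'a set" and Val :: "'v set" and t :: "'v \<Rightarrow> 'a" and \<phi> :: "'a fm"
  assumes "bcl Atm Val t"
    and "\<phi> \<in> bcl.lang Atm"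
  shows "((\<forall>X\<in>modalities \<phi>. X \<subseteq> Atm - bcl.Dec Val t) \<longrightarrow>
      (bcl.BCL Atm Val t \<phi> \<longleftrightarrow>
        (\<forall>S f. bcl.classifier_model Atm Val t (S, f) \<longrightarrow> (\<forall>s\<in>S. bcl.sat Val t (S, f) s \<phi>))))
    \<and> (bcl.BCL Atm Val t \<phi> \<longleftrightarrow>
        (\<forall>S f. bcl.classifier_model Atm Val t (S, f) \<longrightarrow> (\<forall>s\<in>S. bcl.sat_dec Val t (S, f) s \<phi>)))"
proof -
  interpret bcl Atm Val t by fact
  have "Atm \<noteq> {}" using assms(2) by (induction rule: lang.induct) auto
  then interpret bcl_nonempty Atm Val t by unfold_locales
  have "BCL \<phi> \<longleftrightarrow> (\<forall>S f. classifier_model (S, f) \<longrightarrow> (\<forall>s\<in>S. sat_dec (S, f) s \<phi>))"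
    using soundness completeness[OF assms(2)] by blast
  then show ?thesis using sat_dec_eq_sat[of \<phi>] by simp
qed

end
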